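(* Let $X$ be a Banach space, $C\subseteq X$, and $T:C\to C$ a mapping such that $B_r[p]\subset\mathrm{Fix}(T)$ for some $p\in X$ and $r>0$. Let $x\in C$ and suppose $\|x-p\|<K$ for some $K>0$. Suppose that $\Phi:(0,2]\to(0,1]$ is a modulus of uniform convexity for $X$, i.e. $$\forall x_1,x_2\in B_1[0],\ \forall \varepsilon\in(0,2]\ \left(\tfrac12\|x_1+x_2\|\ge 1-\Phi(\varepsilon)\ \Rightarrow\ \|x_1-x_2\|\le\varepsilon\right),$$ and that $\Gamma(K,r,\varepsilon,g,N)\in\mathbb{N}$ is a metastable rate of asymptotic decreasingness for $(\|T^nx-q\|)_{n\in\mathbb{N}}$, uniform for $q\in B_r[p]$, i.e. for every $q\in B_r[p]$, every $\varepsilon>0$, every $g:\mathbb{N}\to\mathbb{N}$ and every $N\in\mathbb{N}$, $$\exists n\le\Gamma(K,r,\varepsilon,g,N)\ \forall i\in[n,n+g(n)]\ \left(\|T^ix-q\|\le\|T^Nx-q\|+\varepsilon\right).$$ Then for every $\varepsilon\in(0,8K]$ and every $g:\mathbb{N}\to\mathbb{N}$, $$\exists n\le\Omega(\Phi,\Gamma,K,r,\varepsilon,g)\ \forall i,j\in[n,n+g(n)]\ \left(\|T^ix-T^jx\|\le\varepsilon\right),$$ where $$\Omega(\Phi,\Gamma,K,r,\varepsilon,g):=\Gamma^\ast\left(K,r,\eta,g,f^{(\lceil K/\eta\rceil)}(0)\right),$$ $$f(j):=\Gamma^\ast(K,r,\eta,g,j)+g^\ast\left(\Gamma^\ast(K,r,\eta,g,j)\right),$$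 $$\eta:=\tfrac r4\cdot\min\left\{1,\Psi\left(\min\{\tfrac14,\tfrac rK\},\tfrac{\varepsilon}{2K}\right)\right\},$$ $$\Psi(h,\varepsilon'):=\min\left\{\tfrac{\varepsilon'}2,\,2h\,\Phi(\tfrac{\varepsilon'}2)\right\}.$$
   Context: $\mathbb{N}$ includes $0$. $B_r[p]$ is the closed ball of radius $r$ centred at $p$ in $X$; $\mathrm{Fix}(T)$ is the set of fixed points of $T$. $[n,m]$ denotes the set of natural numbers $i$ with $n\le i\le m$. For $g:\mathbb{N}\to\mathbb{N}$, $g^\ast(n):=\max(\{n\}\cup\{g(i):i\le n\})$. Likewise $\Gamma^\ast(K,r,\varepsilon,g,N):=\max(\{N\}\cup\{\Gamma(K,r,\varepsilon,g,i):i\le N\})$. $f^{(m)}$ denotes the $m$-fold iterate of $f$. *)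

theory Defs
  imports "HOL-Analysis.Analysis"
begin

definition Fix :: "'a set \<Rightarrow> ('a \<Rightarrow> 'a) \<Rightarrow> 'a set" where
  "Fix C T = {x \<in> C. T x = x}"

text \<open>The type argument carries the space. A modulus is only meant on \<open>(0,2]\<close>; its values
  elsewhere are irrelevant.\<close>

definition modulus_of_uniform_convexity ::
    "'a::real_normed_vector itself \<Rightarrow> (real \<Rightarrow> real) \<Rightarrow> bool" where
  "modulus_of_uniform_convexity X \<Phi> \<longleftrightarrow>
     \<Phi> \<in> {0<..2} \<rightarrow> {0<..1} \<and>
     (\<forall>x1\<in>cball (0::'a) 1. \<forall>x2\<in>cball (0::'a) 1. \<forall>\<epsilon>\<in>{0<..2}.
        1 / 2 * norm (x1 + x2) \<ge> 1 - \<Phi> \<epsilon> \<longrightarrow> norm (x1 - x2) \<le> \<epsilon>)"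

text \<open>In the next definition \<open>n\<close> is not required to be at least \<open>N\<close>.\<close>

definition metastable_rate_of_asymptotic_decreasingness ::
    "(nat \<Rightarrow> real) \<Rightarrow> (real \<Rightarrow> (nat \<Rightarrow> nat) \<Rightarrow> nat \<Rightarrow> nat) \<Rightarrow> bool" where
  "metastable_rate_of_asymptotic_decreasingness a \<gamma> \<longleftrightarrow>
     (\<forall>\<epsilon>>0. \<forall>g N. \<exists>n\<le>\<gamma> \<epsilon> g N. \<forall>i\<in>{n..n + g n}. a i \<le> a N + \<epsilon>)"

text \<open>\<open>star g\<close> is the monotone majorant written \<open>g\<^sup>*\<close>. For a rate \<open>\<Gamma>\<close>, the function
  \<open>\<Gamma>\<^sup>*\<close> is obtained by majorising in the last argument only, so that
  \<open>\<Gamma>\<^sup>* K r \<epsilon> g N = star (\<Gamma> K r \<epsilon> g) N\<close>.\<close>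

definition star :: "(nat \<Rightarrow> nat) \<Rightarrow> nat \<Rightarrow> nat" where
  "star g n = Max ({n} \<union> {g i | i. i \<le> n})"

type_synonym rate = "real \<Rightarrow> real \<Rightarrow> real \<Rightarrow> (nat \<Rightarrow> nat) \<Rightarrow> nat \<Rightarrow> nat"

definition rate_star :: "rate \<Rightarrow> rate" where
  "rate_star \<Gamma> K r \<epsilon> g N = star (\<Gamma> K r \<epsilon> g) N"

definition Psi :: "(real \<Rightarrow> real) \<Rightarrow> real \<Rightarrow> real \<Rightarrow> real" where
  "Psi \<Phi> h \<epsilon> = min (\<epsilon> / 2) (2 * h * \<Phi> (\<epsilon> / 2))"

definition eta :: "(real \<Rightarrow> real) \<Rightarrow> real \<Rightarrow> real \<Rightarrow> real \<Rightarrow> real" where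
  "eta \<Phi> K r \<epsilon> = r / 4 * min 1 (Psi \<Phi> (min (1 / 4) (r / K)) (\<epsilon> / (2 * K)))"

definition step :: "rate \<Rightarrow> real \<Rightarrow> real \<Rightarrow> real \<Rightarrow> (nat \<Rightarrow> nat) \<Rightarrow> nat \<Rightarrow> nat" where
  "step \<Gamma> K r \<eta> g j = rate_star \<Gamma> K r \<eta> g j + star g (rate_star \<Gamma> K r \<eta> g j)"

definition Omega ::
    "(real \<Rightarrow> real) \<Rightarrow> rate \<Rightarrow> real \<Rightarrow> real \<Rightarrow> real \<Rightarrow> (nat \<Rightarrow> nat) \<Rightarrow> nat" where
  "Omega \<Phi> \<Gamma> K r \<epsilon> g =
     (let \<eta> = eta \<Phi> K r \<epsilon>; f = step \<Gamma> K r \<eta> g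
      in rate_star \<Gamma> K r \<eta> g ((f ^^ nat \<lceil>K / \<eta>\<rceil>) 0))"

end

theory Submission
  imports Defs
begin

text \<open>Write \<open>x\<^sub>n = T\<^sup>n x\<close>. Along the iterates of \<open>f\<close> the distance to \<open>p\<close> cannot drop by \<open>\<eta>\<close>
  more than \<open>\<lceil>K / \<eta>\<rceil>\<close> times, so some \<open>N\<close> satisfies \<open>\<parallel>x\<^sub>N - p\<parallel> \<le> \<parallel>x\<^sub>i - p\<parallel> + \<eta>\<close> for all
  \<open>i \<le> f(N)\<close>. If \<open>\<parallel>x\<^sub>N - p\<parallel> \<le> r\<close>, then \<open>x\<^sub>N\<close> is a fixed point. Otherwise let \<open>q\<close> be the point at
  distance \<open>r/2\<close> from \<open>p\<close> on the segment from \<open>p\<close> to \<open>x\<^sub>N\<close>. The metastable rate for \<open>q\<close>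
  makes the path from \<open>p\<close> via \<open>q\<close> to \<open>x\<^sub>i\<close> almost as short as \<open>\<parallel>x\<^sub>i - p\<parallel>\<close>, so by uniform
  convexity \<open>x\<^sub>i - q\<close> is almost parallel to \<open>q - p\<close>, hence \<open>x\<^sub>i\<close> is close to \<open>x\<^sub>N\<close>.\<close>

lemma star_ge_self: "n \<le> star g n"
  unfolding star_def by (intro Max_ge) auto

lemma star_ge: "i \<le> n \<Longrightarrow> g i \<le> star g n"
  unfolding star_def by (intro Max_ge) auto

lemma mono_star: "mono (star g)"
proof (rule monoI)
  fix m n :: nat
  assume "m \<le> n"
  then have "k \<le> star g n" if "k \<in> {m} \<union> {g i | i. i \<le> m}" for k
    using that star_ge_self[of n g] star_ge[of _ n g] by auto
  then show "star g m \<le> star g n"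
    unfolding star_def[of g m] by (intro Max.boundedI) auto
qed

lemma mono_step: "mono (step \<Gamma> K r \<eta> g)"
  unfolding step_def rate_star_def
  by (intro monoI add_mono monoD[OF mono_star])

lemma step_ge_self: "j \<le> step \<Gamma> K r \<eta> g j"
  unfolding step_def rate_star_def by (simp add: star_ge_self trans_le_add1)

text \<open>If every admissible \<open>N\<close> failed, each failure would supply an index
  \<open>i \<le> f N\<close> where \<open>a\<close> is lower by more than \<open>\<eta>\<close>.
  Monotonicity of \<open>f\<close> keeps that index below the next iterate, so after
  \<open>\<lceil>K / \<eta>\<rceil>\<close> drops \<open>a\<close> would be negative.\<close>

lemma almost_minimal_index:
  fixes a :: "nat \<Rightarrow> real"
  assumes nonneg: "\<And>n. 0 \<le> a n" and "a 0 < K" and "\<eta> > 0"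
    and "mono f" and ge_self: "\<And>j. j \<le> f j"
  obtains N where "N \<le> (f ^^ nat \<lceil>K / \<eta>\<rceil>) 0" "a N \<le> a 0" "\<And>i. i \<le> f N \<Longrightarrow> a N \<le> a i + \<eta>"
proof -
  define M where "M = nat \<lceil>K / \<eta>\<rceil>"
  have "\<exists>N\<le>(f ^^ M) 0. a N \<le> a 0 \<and> (\<forall>i\<le>f N. a N \<le> a i + \<eta>)"
  proof (rule ccontr)
    assume none: "\<not> ?thesis"
    have "k \<le> M \<Longrightarrow> \<exists>N\<le>(f ^^ k) 0. a N \<le> a 0 - real k * \<eta>" for k
    proof (induction k)
      case 0
      show ?case by simp
    next
      case (Suc k)
      then obtain N where N: "N \<le> (f ^^ k) 0" "a N \<le> a 0 - real k * \<eta>" by auto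
      have "(f ^^ k) 0 \<le> (f ^^ M) 0"
        using \<open>Suc k \<le> M\<close> by (intro funpow_mono2[OF \<open>mono f\<close>]) auto
      moreover have "a N \<le> a 0"
        using N(2) \<open>\<eta> > 0\<close> by (smt (verit) mult_nonneg_nonneg of_nat_0_le_iff)
      ultimately have "\<not> (\<forall>i\<le>f N. a N \<le> a i + \<eta>)"
        using none N(1) order_trans by blast
      then obtain i where i: "i \<le> f N" "a i < a N - \<eta>"
        by (auto simp: not_le less_diff_eq)
      have "i \<le> (f ^^ Suc k) 0"
        using i(1) monoD[OF \<open>mono f\<close> N(1)] by simp
      moreover have "a i \<le> a 0 - real (Suc k) * \<eta>"
        using i(2) N(2) by (simp add: algebra_simps)
      ultimately show ?case by blast
    qed
    then obtain N where "a N \<le> a 0 - real M * \<eta>" by blast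
    moreover have "K \<le> real M * \<eta>"
      using real_nat_ceiling_ge[of "K / \<eta>"] \<open>\<eta> > 0\<close> by (simp add: M_def field_simps)
    ultimately show False using nonneg[of N] \<open>a 0 < K\<close> by linarith
  qed
  then show ?thesis using that unfolding M_def by blast
qed

text \<open>With \<open>u\<close> the unit vector towards \<open>y\<close> and \<open>v\<close> the
  rescaled \<open>z - q\<close>, \<open>far\<close> forces \<open>norm (u + v)\<close> to be nearly
  2; the modulus then gives \<open>norm (u - v) \<le> \<delta>\<close>.\<close>

lemma uniform_convexity_close:
  fixes y z p :: "'a::real_normed_vector"
  assumes Phi: "modulus_of_uniform_convexity TYPE('a) \<Phi>"
    and \<delta>: "0 < \<delta>" "\<delta> \<le> 2" and s: "0 < s" "2 * s \<le> norm (y - p)"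
    and \<eta>: "0 < \<eta>" "\<eta> \<le> s * \<Phi> \<delta>"
    and q: "q = p + (s / norm (y - p)) *\<^sub>R (y - p)"
    and near: "norm (z - q) \<le> norm (y - q) + \<eta>"
    and far: "norm (y - p) \<le> norm (z - p) + \<eta>"
  shows "norm (z - y) \<le> norm (y - p) * \<delta> + \<eta>"
proof -
  \<comment> \<open>\<open>c\<close> is the bound on \<open>norm (z - q)\<close> obtained from
    \<open>near\<close>. Dividing by it rather than by the norm puts \<open>v\<close> in the unit
    ball and also covers \<open>z = q\<close>.\<close>
  define d u c v where "d = norm (y - p)" and "u = (1 / d) *\<^sub>R (y - p)"
    and "c = d - s + \<eta>" and "v = (1 / c) *\<^sub>R (z - q)"
  have d: "d > 0" "2 * s \<le> d" and c: "c > 0" "s \<le> c"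
    using s \<eta> by (auto simp: d_def c_def)
  have u: "norm u = 1" using d by (simp add: u_def d_def)
  have y: "y - p = d *\<^sub>R u" using d by (simp add: u_def)
  have q': "q = p + s *\<^sub>R u" by (simp add: q u_def d_def)
  have yq: "y - q = (d - s) *\<^sub>R u" using y q' by (simp add: algebra_simps)
  have z: "z - q = c *\<^sub>R v" using c by (simp add: v_def)
  have "norm (y - q) = d - s" using yq u d s by simp
  then have "c * norm v \<le> c" using near z c by (simp add: c_def)
  then have v: "norm v \<le> 1" using c by simp
  \<comment> \<open>Equal weights on \<open>u\<close> and \<open>v\<close> isolate their sum; the
    remaining weight \<open>c - s\<close> is nonnegative because
    \<open>2 * s \<le> d\<close>.\<close>
  have "z - p = s *\<^sub>R (u + v) + (c - s) *\<^sub>R v"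
    using z q' by (simp add: algebra_simps)
  then have "norm (z - p) \<le> s * norm (u + v) + (c - s) * norm v"
    using norm_triangle_ineq[of "s *\<^sub>R (u + v)" "(c - s) *\<^sub>R v"] s c by simp
  also have "\<dots> \<le> s * norm (u + v) + (c - s)"
    using v c by (simp add: mult_left_le)
  finally have "2 * s - 2 * \<eta> \<le> s * norm (u + v)"
    using far by (simp add: c_def d_def)
  then have "s * (2 - 2 * \<Phi> \<delta>) \<le> s * norm (u + v)"
    using \<eta> by (simp add: algebra_simps)
  then have "1 / 2 * norm (u + v) \<ge> 1 - \<Phi> \<delta>" using s by simp
  then have uv: "norm (u - v) \<le> \<delta>"
    using Phi u v \<delta> unfolding modulus_of_uniform_convexity_def by simp
  have "z - y = (z - q) - (y - q)" by simp
  also have "\<dots> = (d - s) *\<^sub>R (v - u) + \<eta> *\<^sub>R v"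
    unfolding z yq by (simp add: c_def algebra_simps)
  finally have "z - y = (d - s) *\<^sub>R (v - u) + \<eta> *\<^sub>R v" .
  then have "norm (z - y) \<le> (d - s) * norm (v - u) + \<eta> * norm v"
    using norm_triangle_ineq[of "(d - s) *\<^sub>R (v - u)" "\<eta> *\<^sub>R v"] s d \<eta> by simp
  also have "\<dots> \<le> d * \<delta> + \<eta> * 1"
    using uv v s d \<eta> by (intro add_mono mult_mono) (auto simp: norm_minus_commute)
  finally show ?thesis by (simp add: d_def)
qed

text \<open>These bounds serve \<open>uniform_convexity_close\<close> with \<open>s = r / 2\<close>
  and \<open>\<delta> = \<epsilon> / (4 * K)\<close>: one controls the additive error, the other is
  its condition on \<open>\<Phi>\<close>.\<close>

lemma
  assumes Phi: "modulus_of_uniform_convexity TYPE('a::real_normed_vector) \<Phi>"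
    and r: "r > 0" and K: "K > 0" and \<epsilon>: "0 < \<epsilon>" "\<epsilon> \<le> 8 * K"
  shows eta_pos: "eta \<Phi> K r \<epsilon> > 0"
    and eta_le_eps: "eta \<Phi> K r \<epsilon> \<le> r * \<epsilon> / (16 * K)"
    and eta_le_Phi: "eta \<Phi> K r \<epsilon> \<le> r / 2 * \<Phi> (\<epsilon> / (4 * K))"
proof -
  define \<delta> where "\<delta> = \<epsilon> / (4 * K)"
  \<comment> \<open>Here \<open>\<epsilon> \<le> 8 * K\<close> places \<open>\<delta>\<close> in the
    domain of the modulus.\<close>
  have "0 < \<delta>" "\<delta> \<le> 2" using K \<epsilon> by (auto simp: \<delta>_def field_simps)
  then have pos: "\<Phi> \<delta> > 0"
    using Phi unfolding modulus_of_uniform_convexity_def by (auto simp: Pi_iff)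
  have eta: "eta \<Phi> K r \<epsilon> = r / 4 * min 1 (min \<delta> (2 * min (1 / 4) (r / K) * \<Phi> \<delta>))"
    by (simp add: eta_def Psi_def \<delta>_def)
  show "eta \<Phi> K r \<epsilon> > 0"
    unfolding eta using r K pos \<open>0 < \<delta>\<close> by simp
  have "eta \<Phi> K r \<epsilon> \<le> r / 4 * \<delta>"
    unfolding eta using r by (intro mult_left_mono) auto
  then show "eta \<Phi> K r \<epsilon> \<le> r * \<epsilon> / (16 * K)" by (simp add: \<delta>_def)
  have "2 * min (1 / 4) (r / K) * \<Phi> \<delta> \<le> 2 * \<Phi> \<delta>"
    using pos by (intro mult_right_mono) auto
  then have "eta \<Phi> K r \<epsilon> \<le> r / 4 * (2 * \<Phi> \<delta>)"
    unfolding eta using r by (intro mult_left_mono) auto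
  then show "eta \<Phi> K r \<epsilon> \<le> r / 2 * \<Phi> (\<epsilon> / (4 * K))" by (simp add: \<delta>_def)
qed

theorem theorem5p6:
  fixes C :: "'a::banach set" and T :: "'a \<Rightarrow> 'a" and p x :: 'a and r K :: real
    and \<Phi> :: "real \<Rightarrow> real" and \<Gamma> :: rate
  assumes T: "T \<in> C \<rightarrow> C"
    and r: "r > 0"
    and ball: "cball p r \<subseteq> Fix C T"
    and x: "x \<in> C"
    and K: "K > 0" "norm (x - p) < K"
    and Phi: "modulus_of_uniform_convexity TYPE('a) \<Phi>"
    and Gamma: "\<And>q. q \<in> cball p r \<Longrightarrow>
      metastable_rate_of_asymptotic_decreasingness (\<lambda>n. norm ((T ^^ n) x - q)) (\<Gamma> K r)"
  shows "\<forall>\<epsilon>\<in>{0<..8 * K}. \<forall>g :: nat \<Rightarrow> nat.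
    \<exists>n\<le>Omega \<Phi> \<Gamma> K r \<epsilon> g. \<forall>i\<in>{n..n + g n}. \<forall>j\<in>{n..n + g n}.
      norm ((T ^^ i) x - (T ^^ j) x) \<le> \<epsilon>"
proof (intro ballI allI)
  fix \<epsilon> :: real and g :: "nat \<Rightarrow> nat"
  assume "\<epsilon> \<in> {0<..8 * K}"
  then have \<epsilon>: "0 < \<epsilon>" "\<epsilon> \<le> 8 * K" by auto
  define \<eta> f X where "\<eta> = eta \<Phi> K r \<epsilon>" and "f = step \<Gamma> K r \<eta> g" and "X n = (T ^^ n) x" for n
  note \<eta> = eta_pos[OF Phi r K(1) \<epsilon>] eta_le_eps[OF Phi r K(1) \<epsilon>] eta_le_Phi[OF Phi r K(1) \<epsilon>]
  obtain N where N: "N \<le> (f ^^ nat \<lceil>K / \<eta>\<rceil>) 0" "norm (X N - p) \<le> norm (X 0 - p)"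
    and N_min: "\<And>i. i \<le> f N \<Longrightarrow> norm (X N - p) \<le> norm (X i - p) + \<eta>"
    using almost_minimal_index[of "\<lambda>n. norm (X n - p)" K \<eta> f] K(2) \<eta>(1) mono_step step_ge_self
    unfolding f_def \<eta>_def X_def by auto
  \<comment> \<open>\<open>G\<close> dominates both \<open>N\<close>, the witness when
    \<open>X N\<close> is in the ball, and \<open>\<Gamma> K r \<eta> g N\<close>, which bounds the
    witness otherwise.\<close>
  define G where "G = star (\<Gamma> K r \<eta> g) N"
  have G_le: "G \<le> Omega \<Phi> \<Gamma> K r \<epsilon> g"
    using monoD[OF mono_star N(1)] by (simp add: G_def Omega_def rate_star_def Let_def \<eta>_def f_def)
  have f_N: "f N = G + star g G"
    by (simp add: f_def step_def rate_star_def G_def)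
  have d_less: "norm (X N - p) < K" using N(2) K(2) by (simp add: X_def)
  show "\<exists>n\<le>Omega \<Phi> \<Gamma> K r \<epsilon> g. \<forall>i\<in>{n..n + g n}. \<forall>j\<in>{n..n + g n}.
      norm ((T ^^ i) x - (T ^^ j) x) \<le> \<epsilon>"
  proof (cases "norm (X N - p) \<le> r")
    case True
    then have fixed: "T (X N) = X N"
      using ball by (auto simp: Fix_def dist_norm norm_minus_commute)
    have "X (N + k) = X N" for k
      by (induction k) (use fixed in \<open>auto simp: X_def\<close>)
    then have const: "X i = X N" if "N \<le> i" for i
      using that le_Suc_ex by blast
    have "norm ((T ^^ i) x - (T ^^ j) x) \<le> \<epsilon>" if "N \<le> i" "N \<le> j" for i j
      using const[OF that(1)] const[OF that(2)] \<epsilon> by (simp add: X_def)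
    moreover have "N \<le> G" unfolding G_def by (rule star_ge_self)
    ultimately show ?thesis using G_le by (intro exI[of _ N]) auto
  next
    case False
    define d q where "d = norm (X N - p)" and "q = p + (r / 2 / norm (X N - p)) *\<^sub>R (X N - p)"
    have d: "r < d" "d < K" using False d_less by (auto simp: d_def)
    have "q \<in> cball p r"
      using d r by (simp add: q_def dist_norm flip: d_def)
    then obtain n where n: "n \<le> \<Gamma> K r \<eta> g N"
        and n_dec: "\<And>i. i \<in> {n..n + g n} \<Longrightarrow> norm (X i - q) \<le> norm (X N - q) + \<eta>"
      using Gamma[of q] \<eta>(1) unfolding metastable_rate_of_asymptotic_decreasingness_def X_def \<eta>_def
      by blast
    have "n \<le> G" using n star_ge[of N N "\<Gamma> K r \<eta> g"] by (simp add: G_def)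
    \<comment> \<open>The form of \<open>f\<close> is made for this:
      \<open>g n \<le> star g G\<close> for every \<open>n \<le> G\<close>, so near-minimality at
      \<open>N\<close> reaches the whole window.\<close>
    then have window: "n + g n \<le> f N" unfolding f_N by (simp add: add_mono star_ge)
    have close: "norm (X i - X N) \<le> \<epsilon> / 2" if i: "i \<in> {n..n + g n}" for i
    proof -
      have "norm (X i - X N) \<le> d * (\<epsilon> / (4 * K)) + \<eta>"
        unfolding d_def
      proof (rule uniform_convexity_close[OF Phi _ _ _ _ _ _ q_def n_dec[OF i]])
        show "norm (X N - p) \<le> norm (X i - p) + \<eta>" using N_min window i by simp
      qed (use K(1) \<epsilon> r d \<eta> in \<open>auto simp: d_def \<eta>_def field_simps\<close>)
      \<comment> \<open>From \<open>r < d < K\<close>, the summands are at most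
        \<open>\<epsilon> / 4\<close> and \<open>\<epsilon> / 16\<close>, together below
        \<open>\<epsilon> / 2\<close>.\<close>
      also have "\<dots> \<le> K * (\<epsilon> / (4 * K)) + K * \<epsilon> / (16 * K)"
      proof (rule add_mono)
        show "d * (\<epsilon> / (4 * K)) \<le> K * (\<epsilon> / (4 * K))"
          using d \<epsilon> K(1) by (intro mult_right_mono) auto
        have "r * \<epsilon> / (16 * K) \<le> K * \<epsilon> / (16 * K)"
          using d \<epsilon> K(1) by (intro divide_right_mono mult_right_mono) auto
        then show "\<eta> \<le> K * \<epsilon> / (16 * K)" using \<eta>(2) by (simp add: \<eta>_def)
      qed
      also have "\<dots> \<le> \<epsilon> / 2" using K(1) \<epsilon> by simp
      finally show ?thesis .
    qed
    have "norm (X i - X j) \<le> \<epsilon>" if "i \<in> {n..n + g n}" "j \<in> {n..n + g n}" for i j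
      using norm_triangle_ineq4[of "X i - X N" "X j - X N"] close[OF that(1)] close[OF that(2)]
      by simp
    then show ?thesis using \<open>n \<le> G\<close> G_le unfolding X_def by (meson order_trans)
  qed
qed

end
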